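(* Let $(S,A)$ be a computable physical model in which $A$ is a finite set. Then $(S,A)$ is isomorphic to some computable physical model whose observable quantities are all projection functions $\pi_i^{m}$ (for a suitable length $m$).
   Context: A computable physical model is a pair $(S,A)$ where $S$ (the set of states) is a recursive set of non-negative integers and $A$ (the set of observable quantities) is a set of total recursive functions from the non-negative integers to the non-negative integers. Two physical models $(S,A)$ and $(T,B)$ are isomorphic iff there exist bijections $\phi:S\to T$ and $\psi:A\to B$ such that $\alpha(s)=\psi(\alpha)(\phi(s))$ for all $s\in S$ and $\alpha\in A$. Sequences of non-negative integers are coded as non-negative integers via Cantor's pairing function $\langle x,y\rangle=\frac12(x^2+2xy+y^2+3x+y)$, with $\langle x_1,\dots,x_n\rangle=\langle\langle x_1,\dots,x_{n-1}\rangle,x_n\rangle$. The projection function $\pi_i^n$ ($1\le i\le n$) is defined by $\pi_i^n\langle x_1,\dots,x_n\rangle=x_i$. *)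

theory Defs
  imports Main "HOL-Library.Nat_Bijection"
begin

text \<open>
  Partial recursive functions of finitely many arguments are given by terms together with a
  big-step evaluation relation. The arity is the length of the argument list; \<open>Zero\<close> is the
  constant function 0 of every arity, \<open>Proj i\<close> selects the argument with 0-based index \<open>i\<close>, and
  primitive recursion and minimisation act on the first argument.
\<close>

datatype recf =
    Zero
  | Succ
  | Proj nat
  | Comp recf "recf list"
  | PrimRec recf recf
  | Minim recf

inductive evaluates :: "recf \<Rightarrow> nat list \<Rightarrow> nat \<Rightarrow> bool" where
  zero: "evaluates Zero xs 0"
| succ: "evaluates Succ [x] (Suc x)"
| proj: "i < length xs \<Longrightarrow> evaluates (Proj i) xs (xs ! i)"
| comp: "list_all2 (\<lambda>g y. evaluates g xs y) gs ys \<Longrightarrow> evaluates f ys v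
    \<Longrightarrow> evaluates (Comp f gs) xs v"
| primrec_0: "evaluates f xs v \<Longrightarrow> evaluates (PrimRec f g) (0 # xs) v"
| primrec_Suc: "evaluates (PrimRec f g) (n # xs) u \<Longrightarrow> evaluates g (n # u # xs) v
    \<Longrightarrow> evaluates (PrimRec f g) (Suc n # xs) v"
| minim: "evaluates f (n # xs) 0 \<Longrightarrow> \<forall>m<n. \<exists>k. evaluates f (m # xs) (Suc k)
    \<Longrightarrow> evaluates (Minim f) xs n"

inductive_cases evaluates_ZeroE: "evaluates Zero xs v"
  and evaluates_SuccE: "evaluates Succ xs v"
  and evaluates_ProjE: "evaluates (Proj i) xs v"
  and evaluates_CompE: "evaluates (Comp f gs) xs v"
  and evaluates_PrimRec_0E: "evaluates (PrimRec f g) (0 # xs) v"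
  and evaluates_PrimRec_SucE: "evaluates (PrimRec f g) (Suc n # xs) v"
  and evaluates_MinimE: "evaluates (Minim f) xs v"

lemma evaluates_deterministic:
  "evaluates r xs v \<Longrightarrow> evaluates r xs w \<Longrightarrow> v = w"
proof (induction r xs v arbitrary: w rule: evaluates.induct)
  case (comp xs gs ys f v)
  from comp.prems obtain zs where zs: "list_all2 (\<lambda>g y. evaluates g xs y) gs zs"
    and w: "evaluates f zs w"
    by (rule evaluates_CompE)
  have "ys = zs"
    using comp.IH(1) zs by (auto simp: list_all2_conv_all_nth intro!: nth_equalityI)
  with w comp.IH(2) show ?case by blast
next
  case (minim f n xs)
  from minim.prems have w0: "evaluates f (w # xs) 0"
    and wS: "\<forall>m<w. \<exists>k. evaluates f (m # xs) (Suc k)"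
    by (auto elim: evaluates_MinimE)
  have "\<not> w < n" using minim.IH(2) w0 by fastforce
  moreover have "\<not> n < w" using minim.IH(1) wS by fastforce
  ultimately show ?case by simp
qed (blast elim: evaluates_ZeroE evaluates_SuccE evaluates_ProjE
      evaluates_PrimRec_0E evaluates_PrimRec_SucE)+

definition total_recursive :: "(nat \<Rightarrow> nat) \<Rightarrow> bool" where
  "total_recursive f \<longleftrightarrow> (\<exists>r. \<forall>x. evaluates r [x] (f x))"

definition recursive_set :: "nat set \<Rightarrow> bool" where
  "recursive_set S \<longleftrightarrow> total_recursive (\<lambda>x. if x \<in> S then 1 else 0)"

type_synonym ('s, 'v) physical_model = "'s set \<times> ('s \<Rightarrow> 'v) set"

fun computable_model :: "(nat, nat) physical_model \<Rightarrow> bool" where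
  "computable_model (S, A) \<longleftrightarrow> recursive_set S \<and> (\<forall>\<alpha>\<in>A. total_recursive \<alpha>)"

fun isomorphic_models :: "('s, 'v) physical_model \<Rightarrow> ('t, 'v) physical_model \<Rightarrow> bool" where
  "isomorphic_models (S, A) (T, B) \<longleftrightarrow>
     (\<exists>\<phi> \<psi>. bij_betw \<phi> S T \<and> bij_betw \<psi> A B \<and> (\<forall>s\<in>S. \<forall>\<alpha>\<in>A. \<alpha> s = \<psi> \<alpha> (\<phi> s)))"

text \<open>The library's \<^const>\<open>prod_encode\<close> is Cantor's pairing function in the required orientation:\<close>

lemma prod_encode_formula:
  "prod_encode (x, y) = (x\<^sup>2 + 2 * x * y + y\<^sup>2 + 3 * x + y) div 2"
proof -
  have "x\<^sup>2 + 2 * x * y + y\<^sup>2 + 3 * x + y = (x + y) * Suc (x + y) + x * 2"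
    by (simp add: power2_eq_square algebra_simps)
  then show ?thesis
    by (simp add: prod_encode_def triangle_def)
qed

text \<open>Codes of sequences nest to the left; the value at the empty list is irrelevant.\<close>

fun seq_code :: "nat list \<Rightarrow> nat" where
  "seq_code [] = 0"
| "seq_code (x # xs) = foldl (\<lambda>a b. prod_encode (a, b)) x xs"

lemma seq_code_singleton: "seq_code [x] = x"
  by simp

lemma seq_code_snoc: "xs \<noteq> [] \<Longrightarrow> seq_code (xs @ [x]) = prod_encode (seq_code xs, x)"
  by (cases xs) simp_all

lemma seq_code_inj:
  "length xs = length ys \<Longrightarrow> seq_code xs = seq_code ys \<Longrightarrow> xs = ys"
proof (induction xs arbitrary: ys rule: rev_induct)
  case (snoc x xs)
  from snoc.prems(1) obtain y zs where ys: "ys = zs @ [y]" and len: "length xs = length zs"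
    by (cases ys rule: rev_cases) auto
  show ?case
  proof (cases "xs = []")
    case True
    with snoc.prems ys len show ?thesis by simp
  next
    case False
    with len have "zs \<noteq> []" by auto
    with False snoc.prems(2) ys have "seq_code xs = seq_code zs \<and> x = y"
      by (simp add: seq_code_snoc)
    with snoc.IH[OF len] ys show ?thesis by simp
  qed
qed simp

lemma seq_code_surj: "1 \<le> n \<Longrightarrow> \<exists>xs. length xs = n \<and> seq_code xs = z"
proof (induction n arbitrary: z rule: dec_induct)
  case base
  show ?case by (rule exI[of _ "[z]"]) simp
next
  case (step n)
  obtain a b where z: "z = prod_encode (a, b)"
    by (metis prod_decode_inverse surj_pair)
  from step.IH obtain xs where xs: "length xs = n" "seq_code xs = a" by blast
  with step.hyps have "xs \<noteq> []" by auto
  with xs z show ?case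
    by (intro exI[of _ "xs @ [b]"]) (simp add: seq_code_snoc)
qed

text \<open>
  \<open>seq_proj n i\<close> is the projection with 1-based index \<open>i\<close> on codes of sequences of length \<open>n\<close>.
  It is meaningful for \<open>1 \<le> i \<le> n\<close>; every number is then the code of exactly one such sequence.
\<close>

definition seq_proj :: "nat \<Rightarrow> nat \<Rightarrow> nat \<Rightarrow> nat" where
  "seq_proj n i z = (THE xs. length xs = n \<and> seq_code xs = z) ! (i - 1)"

lemma seq_proj_seq_code: "length xs = n \<Longrightarrow> seq_proj n i (seq_code xs) = xs ! (i - 1)"
proof -
  assume "length xs = n"
  then have "(THE ys. length ys = n \<and> seq_code ys = seq_code xs) = xs"
    by (intro the_equality) (auto intro: seq_code_inj)
  then show ?thesis by (simp add: seq_proj_def)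
qed

end

theory Submission imports Defs begin

text \<open>
  If \<open>A = {h 0, \<dots>, h (k - 1)}\<close>, encode a state \<open>s\<close> by the number
  \<open>\<phi> s = \<langle>s, h 0 s, \<dots>, h (k - 1) s\<rangle>\<close>, so that the observables become projections. Keeping \<open>s\<close>
  itself as the first entry makes \<open>\<phi>\<close> injective, and makes the range \<open>\<phi> ` S\<close> decidable: \<open>z\<close> lies
  in it iff its first entry \<open>s\<close> is in \<open>S\<close> and \<open>\<phi> s = z\<close>.
\<close>

section \<open>Closure properties of recursive functions\<close>

text \<open>Lists of length \<open>n\<close> serve as argument tuples and values of \<open>F\<close>
  at other lengths are unconstrained, so functions of several arguments can be built from closure
  rules without writing \<open>recf\<close> terms.\<close>

definition recursive :: "nat \<Rightarrow> (nat list \<Rightarrow> nat) \<Rightarrow> bool" where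
  "recursive n F \<longleftrightarrow> (\<exists>r. \<forall>xs. length xs = n \<longrightarrow> evaluates r xs (F xs))"

lemma total_recursive_iff: "total_recursive f \<longleftrightarrow> recursive 1 (\<lambda>xs. f (xs ! 0))"
proof
  assume "total_recursive f"
  then obtain r where "\<forall>x. evaluates r [x] (f x)"
    by (auto simp: total_recursive_def)
  then show "recursive 1 (\<lambda>xs. f (xs ! 0))"
    unfolding recursive_def by (intro exI[of _ r]) (auto simp: length_Suc_conv)
next
  assume "recursive 1 (\<lambda>xs. f (xs ! 0))"
  then obtain r where "\<forall>xs. length xs = 1 \<longrightarrow> evaluates r xs (f (xs ! 0))"
    by (auto simp: recursive_def)
  then have "evaluates r [x] (f x)" for x
    by (metis One_nat_def length_Cons list.size(3) nth_Cons_0)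
  then show "total_recursive f"
    by (auto simp: total_recursive_def)
qed

lemma recursive_zero: "recursive n (\<lambda>_. 0)"
  unfolding recursive_def by (blast intro: evaluates.zero)

lemma recursive_nth: "i < n \<Longrightarrow> recursive n (\<lambda>xs. xs ! i)"
  unfolding recursive_def by (blast intro: evaluates.proj)

lemma recursive_comp1:
  assumes "total_recursive f" "recursive n G"
  shows "recursive n (\<lambda>xs. f (G xs))"
proof -
  obtain r s where "\<forall>x. evaluates r [x] (f x)"
    and "\<forall>xs. length xs = n \<longrightarrow> evaluates s xs (G xs)"
    using assms by (auto simp: total_recursive_def recursive_def)
  then have "length xs = n \<Longrightarrow> evaluates (Comp r [s]) xs (f (G xs))" for xs
    by (auto intro!: evaluates.comp[where ys = "[G xs]"])
  then show ?thesis by (auto simp: recursive_def)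
qed

lemma recursive_comp2:
  assumes "recursive 2 (\<lambda>xs. f (xs ! 0) (xs ! 1))" "recursive n G" "recursive n H"
  shows "recursive n (\<lambda>xs. f (G xs) (H xs))"
proof -
  obtain r s t where r: "\<forall>xs. length xs = 2 \<longrightarrow> evaluates r xs (f (xs ! 0) (xs ! 1))"
    and st: "\<forall>xs. length xs = n \<longrightarrow> evaluates s xs (G xs)"
      "\<forall>xs. length xs = n \<longrightarrow> evaluates t xs (H xs)"
    using assms by (auto simp: recursive_def)
  have "evaluates r [x, y] (f x y)" for x y
    using r[rule_format, of "[x, y]"] by simp
  with st have "length xs = n \<Longrightarrow> evaluates (Comp r [s, t]) xs (f (G xs) (H xs))" for xs
    by (auto intro!: evaluates.comp[where ys = "[G xs, H xs]"])
  then show ?thesis by (auto simp: recursive_def)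
qed

text \<open>The recursion equations are hypotheses, so \<open>H\<close> may be any closed expression
  satisfying them. In \<open>G\<close>, entry 0 is the counter and entry 1 the previous
  value.\<close>

lemma recursive_primrec:
  assumes "recursive n F" "recursive (Suc (Suc n)) G"
    and H0: "\<And>xs. length xs = n \<Longrightarrow> H (0 # xs) = F xs"
    and HS: "\<And>k xs. length xs = n \<Longrightarrow> H (Suc k # xs) = G (k # H (k # xs) # xs)"
  shows "recursive (Suc n) H"
proof -
  obtain r s where r: "\<forall>xs. length xs = n \<longrightarrow> evaluates r xs (F xs)"
    and s: "\<forall>xs. length xs = Suc (Suc n) \<longrightarrow> evaluates s xs (G xs)"
    using assms by (auto simp: recursive_def)
  have "evaluates (PrimRec r s) (k # xs) (H (k # xs))" if "length xs = n" for k xs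
  proof (induction k)
    case 0
    show ?case using r that by (auto simp: H0 intro: evaluates.primrec_0)
  next
    case (Suc k)
    show ?case
      by (rule evaluates.primrec_Suc[OF Suc]) (use s that in \<open>simp add: HS\<close>)
  qed
  then show ?thesis
    unfolding recursive_def by (intro exI[of _ "PrimRec r s"]) (auto simp: length_Suc_conv)
qed

lemma recursive_Least:
  assumes "recursive (Suc n) F"
    and ex: "\<And>xs. length xs = n \<Longrightarrow> \<exists>k. F (k # xs) = 0"
  shows "recursive n (\<lambda>xs. LEAST k. F (k # xs) = 0)"
proof -
  obtain r where r: "\<forall>xs. length xs = Suc n \<longrightarrow> evaluates r xs (F xs)"
    using assms by (auto simp: recursive_def)
  have "evaluates (Minim r) xs (LEAST k. F (k # xs) = 0)" if len: "length xs = n" for xs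
  proof (rule evaluates.minim)
    have "F ((LEAST k. F (k # xs) = 0) # xs) = 0"
      using ex[OF len] by (rule LeastI_ex)
    then show "evaluates r ((LEAST k. F (k # xs) = 0) # xs) 0"
      using r len by (metis length_Cons)
    \<comment> \<open>Minimisation requires a defined positive value at every smaller argument;
      minimality of the least zero makes these values successors.\<close>
    show "\<forall>j<(LEAST k. F (k # xs) = 0). \<exists>l. evaluates r (j # xs) (Suc l)"
    proof (intro allI impI)
      fix j assume "j < (LEAST k. F (k # xs) = 0)"
      then obtain l where "F (j # xs) = Suc l"
        using not_less_Least not0_implies_Suc by blast
      moreover have "evaluates r (j # xs) (F (j # xs))"
        using r len by simp
      ultimately show "\<exists>l. evaluates r (j # xs) (Suc l)" by auto
    qed
  qed
  then show ?thesis by (auto simp: recursive_def)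
qed

lemma total_recursive_comp:
  "total_recursive f \<Longrightarrow> total_recursive g \<Longrightarrow> total_recursive (\<lambda>x. f (g x))"
  unfolding total_recursive_iff[of g] total_recursive_iff[of "\<lambda>x. f (g x)"]
  by (rule recursive_comp1)

lemma total_recursive_comp2:
  "recursive 2 (\<lambda>xs. f (xs ! 0) (xs ! 1)) \<Longrightarrow> total_recursive g \<Longrightarrow> total_recursive h \<Longrightarrow>
    total_recursive (\<lambda>x. f (g x) (h x))"
  unfolding total_recursive_iff by (rule recursive_comp2)

lemma total_recursive_id: "total_recursive (\<lambda>x. x)"
  unfolding total_recursive_iff by (rule recursive_nth) simp

section \<open>Arithmetic and the pairing function\<close>

lemma total_recursive_Suc: "total_recursive Suc"
  unfolding total_recursive_def by (blast intro: evaluates.succ)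

lemma total_recursive_pred: "total_recursive (\<lambda>x. x - 1)"
proof -
  have "recursive (Suc 0) (\<lambda>xs. xs ! 0 - 1)"
    \<comment> \<open>The recursion step ignores the previous value and returns the counter, which
      is the predecessor.\<close>
    by (rule recursive_primrec[OF recursive_zero recursive_nth[of 0]]) simp_all
  then show ?thesis by (simp add: total_recursive_iff)
qed

lemma recursive_add: "recursive 2 (\<lambda>xs. xs ! 0 + xs ! 1)"
proof -
  have "recursive (Suc 1) (\<lambda>xs. xs ! 0 + xs ! 1)"
    by (rule recursive_primrec[OF recursive_nth[of 0]
          recursive_comp1[OF total_recursive_Suc recursive_nth[of 1]]]) simp_all
  then show ?thesis by (simp add: numeral_2_eq_2)
qed

lemma recursive_diff: "recursive 2 (\<lambda>xs. xs ! 0 - xs ! 1)"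
proof -
  \<comment> \<open>Subtraction iterates the predecessor, so the subtrahend must be the recursion
    variable and come first; the arguments are swapped afterwards.\<close>
  have "recursive (Suc 1) (\<lambda>xs. xs ! 1 - xs ! 0)"
    by (rule recursive_primrec[OF recursive_nth[of 0]
          recursive_comp1[OF total_recursive_pred recursive_nth[of 1]]]) simp_all
  then have "recursive 2 (\<lambda>xs. xs ! 1 - xs ! 0)" by (simp add: numeral_2_eq_2)
  then show ?thesis
    by (rule recursive_comp2[of "\<lambda>y x. x - y"]) (simp_all add: recursive_nth)
qed

lemma total_recursive_triangle: "total_recursive triangle"
proof -
  have "recursive (Suc 0) (\<lambda>xs. triangle (xs ! 0))"
    by (rule recursive_primrec[OF recursive_zero
          recursive_comp2[OF recursive_add recursive_nth[of 1]
            recursive_comp1[OF total_recursive_Suc recursive_nth[of 0]]]]) simp_all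
  then show ?thesis by (simp add: total_recursive_iff)
qed

lemma recursive_prod_encode: "recursive 2 (\<lambda>xs. prod_encode (xs ! 0, xs ! 1))"
  unfolding prod_encode_def prod.case
  by (intro recursive_comp2[OF recursive_add] recursive_comp1[OF total_recursive_triangle]
      recursive_nth) simp_all

text \<open>The diagonal \<open>x + y\<close> on which the code \<open>z\<close> of \<open>(x, y)\<close> lies can be found by an unbounded
  search; \<open>x\<close> and \<open>y\<close> are then obtained by subtraction.\<close>

lemma Least_triangle_prod_encode:
  "(LEAST w. Suc (prod_encode (x, y)) - triangle (Suc w) = 0) = x + y"
proof (rule Least_equality)
  \<comment> \<open>With truncated subtraction the equation says that the code is less than
    \<open>triangle (Suc w)\<close>. The code is \<open>triangle (x + y) + x\<close>, which lies in
    the half-open interval from \<open>triangle (x + y)\<close> to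
    \<open>triangle (Suc (x + y))\<close>.\<close>
  show "Suc (prod_encode (x, y)) - triangle (Suc (x + y)) = 0"
    by (simp add: prod_encode_def)
next
  fix w assume w: "Suc (prod_encode (x, y)) - triangle (Suc w) = 0"
  show "x + y \<le> w"
  proof (rule ccontr)
    assume "\<not> x + y \<le> w"
    then have "triangle (Suc w) \<le> triangle (x + y)"
      unfolding triangle_def by (intro div_le_mono mult_le_mono) simp_all
    with w show False by (simp add: prod_encode_def)
  qed
qed

lemma total_recursive_diagonal: "total_recursive (\<lambda>z. fst (prod_decode z) + snd (prod_decode z))"
proof -
  define F where "F = (\<lambda>xs. Suc (xs ! 1) - triangle (Suc (xs ! 0)))"
  have "recursive (Suc 1) F"
    unfolding F_def
    by (intro recursive_comp2[OF recursive_diff] recursive_comp1[OF total_recursive_triangle]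
        recursive_comp1[OF total_recursive_Suc] recursive_nth) simp_all
  then have "recursive 1 (\<lambda>xs. LEAST w. F (w # xs) = 0)"
  proof (rule recursive_Least)
    fix xs :: "nat list"
    show "\<exists>w. F (w # xs) = 0"
      \<comment> \<open>The number \<open>z\<close> itself bounds the search, since
        \<open>triangle (Suc z) = triangle z + Suc z\<close>.\<close>
      by (rule exI[of _ "xs ! 0"]) (simp add: F_def)
  qed
  moreover have "(LEAST w. Suc z - triangle (Suc w) = 0)
      = fst (prod_decode z) + snd (prod_decode z)" for z
    using Least_triangle_prod_encode[of "fst (prod_decode z)" "snd (prod_decode z)"] by simp
  ultimately show ?thesis by (simp add: total_recursive_iff F_def)
qed

lemma total_recursive_fst_prod_decode: "total_recursive (\<lambda>z. fst (prod_decode z))"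
proof -
  have "prod_encode (x, y) - triangle (x + y) = x" for x y
    by (simp add: prod_encode_def)
  from this[of "fst (prod_decode z)" "snd (prod_decode z)" for z]
  have "z - triangle (fst (prod_decode z) + snd (prod_decode z)) = fst (prod_decode z)" for z
    by simp
  moreover have
    "total_recursive (\<lambda>z. z - triangle (fst (prod_decode z) + snd (prod_decode z)))"
    by (intro total_recursive_comp2[OF recursive_diff] total_recursive_id
        total_recursive_comp[OF total_recursive_triangle] total_recursive_diagonal)
  ultimately show ?thesis by simp
qed

lemma total_recursive_snd_prod_decode: "total_recursive (\<lambda>z. snd (prod_decode z))"
  using total_recursive_comp2[OF recursive_diff total_recursive_diagonal
      total_recursive_fst_prod_decode] by simp

section \<open>Codes of sequences\<close>

text \<open>Codes nest to the left, so the induction removes the last function. A singleton is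
  treated separately because its code is the entry itself and not a pair.\<close>

lemma total_recursive_seq_code:
  "(\<And>f. f \<in> set fs \<Longrightarrow> total_recursive f) \<Longrightarrow> total_recursive (\<lambda>x. seq_code (map (\<lambda>f. f x) fs))"
proof (induction fs rule: rev_induct)
  case Nil
  show ?case by (simp add: total_recursive_iff recursive_zero)
next
  case (snoc f fs)
  show ?case
  proof (cases "fs = []")
    case True
    with snoc.prems show ?thesis by simp
  next
    case False
    have "total_recursive (\<lambda>x. prod_encode (seq_code (map (\<lambda>f. f x) fs), f x))"
      by (rule total_recursive_comp2[OF recursive_prod_encode]) (use snoc in auto)
    with False show ?thesis by (simp add: seq_code_snoc)
  qed
qed

text \<open>This replaces the definite description in \<open>seq_proj\<close> by a recursion on the
  length. By surjectivity of the coding, the first component of \<open>z\<close> is the code of some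
  sequence of length \<open>m\<close>, and the second component is the entry appended to it.\<close>

lemma seq_proj_Suc:
  assumes "1 \<le> i" "i \<le> Suc m" "1 \<le> m"
  shows "seq_proj (Suc m) i z =
    (if i = Suc m then snd (prod_decode z) else seq_proj m i (fst (prod_decode z)))"
proof -
  obtain xs where xs: "length xs = m" "seq_code xs = fst (prod_decode z)"
    using seq_code_surj[OF \<open>1 \<le> m\<close>] by blast
  with \<open>1 \<le> m\<close> have "seq_code (xs @ [snd (prod_decode z)]) = z"
    by (subst seq_code_snoc) auto
  then have "seq_proj (Suc m) i z = (xs @ [snd (prod_decode z)]) ! (i - 1)"
    using xs(1) seq_proj_seq_code[of "xs @ [snd (prod_decode z)]" "Suc m" i] by simp
  moreover have "seq_proj m i (fst (prod_decode z)) = xs ! (i - 1)"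
    using seq_proj_seq_code[OF xs(1), of i] xs(2) by simp
  ultimately show ?thesis
    using assms xs(1) by (auto simp: nth_append)
qed

lemma total_recursive_seq_proj:
  "1 \<le> m \<Longrightarrow> 1 \<le> i \<Longrightarrow> i \<le> m \<Longrightarrow> total_recursive (seq_proj m i)"
proof (induction m rule: dec_induct)
  case base
  have "seq_proj 1 1 z = z" for z
    using seq_proj_seq_code[of "[z]" 1 1] by simp
  then have "seq_proj 1 1 = (\<lambda>z. z)" by (rule ext)
  moreover have "i = 1" using base by simp
  ultimately show ?case by (metis total_recursive_id)
next
  case (step m)
  show ?case
  proof (cases "i = Suc m")
    case True
    with step.prems step.hyps have "seq_proj (Suc m) i = (\<lambda>z. snd (prod_decode z))"
      by (auto simp: seq_proj_Suc)
    then show ?thesis by (simp add: total_recursive_snd_prod_decode)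
  next
    case False
    with step.prems step.hyps
    have "seq_proj (Suc m) i = (\<lambda>z. seq_proj m i (fst (prod_decode z)))"
      by (auto simp: seq_proj_Suc)
    moreover have "total_recursive (seq_proj m i)"
      using False step.prems by (intro step.IH) auto
    then have "total_recursive (\<lambda>z. seq_proj m i (fst (prod_decode z)))"
      using total_recursive_fst_prod_decode by (rule total_recursive_comp)
    ultimately show ?thesis by simp
  qed
qed

lemma inj_on_seq_proj: "inj_on (seq_proj m) {1..m}"
proof (rule inj_onI)
  fix i j assume "i \<in> {1..m}" "j \<in> {1..m}" "seq_proj m i = seq_proj m j"
  \<comment> \<open>The code of a sequence with distinct entries separates the projections.\<close>
  moreover from this(3) have "[0..<m] ! (i - 1) = [0..<m] ! (j - 1)"
    using seq_proj_seq_code[of "[0..<m]" m] by (metis diff_zero length_upt)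
  ultimately show "i = j" by auto
qed

text \<open>The left inverse supplies the only possible preimage \<open>g z\<close> of
  \<open>z\<close>, so membership is settled by one check instead of an unbounded search.\<close>

lemma recursive_set_image_retraction:
  assumes "recursive_set S" "total_recursive f" "total_recursive g"
    and gf: "\<And>s. s \<in> S \<Longrightarrow> g (f s) = s"
  shows "recursive_set (f ` S)"
proof -
  let ?\<chi> = "\<lambda>s. if s \<in> S then 1 else 0 :: nat"
  have "total_recursive (\<lambda>z. ?\<chi> (g z))"
    using assms(1,3) unfolding recursive_set_def by (rule total_recursive_comp)
  moreover have "total_recursive (\<lambda>z. f (g z))"
    using assms(2,3) by (rule total_recursive_comp)
  \<comment> \<open>The sum of the two truncated differences is the distance between
    \<open>f (g z)\<close> and \<open>z\<close>. It leaves the characteristic value intact if they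
    agree and reduces it to 0 otherwise.\<close>
  ultimately have "total_recursive (\<lambda>z. ?\<chi> (g z) - ((f (g z) - z) + (z - f (g z))))"
    by (intro total_recursive_comp2[OF recursive_diff] total_recursive_comp2[OF recursive_add]
        total_recursive_id)
  moreover have "?\<chi> (g z) - ((f (g z) - z) + (z - f (g z))) = (if z \<in> f ` S then 1 else 0)" for z
    using gf by (auto simp: image_iff)
  ultimately show ?thesis by (simp add: recursive_set_def)
qed

section \<open>Isomorphism onto a model of projections\<close>

theorem theorem1:
  fixes S :: "nat set" and A :: "(nat \<Rightarrow> nat) set"
  assumes "computable_model (S, A)"
    and "finite A"
  shows "\<exists>(T :: nat set) (B :: (nat \<Rightarrow> nat) set) (m :: nat).
           computable_model (T, B) \<and> isomorphic_models (S, A) (T, B) \<and>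
           1 \<le> m \<and> B \<subseteq> {seq_proj m i | i. 1 \<le> i \<and> i \<le> m}"
proof -
  from assms(1) have S: "recursive_set S" and A: "\<And>\<alpha>. \<alpha> \<in> A \<Longrightarrow> total_recursive \<alpha>"
    by auto
  define k where "k = card A"
  obtain h where h: "bij_betw h {0..<k} A"
    using ex_bij_betw_nat_finite[OF \<open>finite A\<close>] unfolding k_def by blast
  define \<phi> where "\<phi> s = seq_code (map (\<lambda>f. f s) ((\<lambda>x. x) # map h [0..<k]))" for s
  \<comment> \<open>One entry for the state and \<open>k\<close> for the observables; thus
    \<open>m\<close> is 1 if \<open>A\<close> is empty.\<close>
  define m where "m = Suc k"
  \<comment> \<open>The state is entry 1 in the 1-based count, so \<open>h i\<close>, with
    \<open>i\<close> counted from 0, supplies entry \<open>i + 2\<close>.\<close>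
  define \<psi> where "\<psi> = (\<lambda>i. seq_proj m (Suc (Suc i))) \<circ> inv_into {0..<k} h"
  define B where "B = (\<lambda>i. seq_proj m (Suc (Suc i))) ` {0..<k}"
  have proj: "seq_proj m i (\<phi> s) = (s # map (\<lambda>i. h i s) [0..<k]) ! (i - 1)" for i s
    unfolding \<phi>_def by (subst seq_proj_seq_code) (simp_all add: m_def comp_def)
  have first: "seq_proj m 1 (\<phi> s) = s" for s
    by (simp add: proj)
  have "total_recursive \<phi>"
    unfolding \<phi>_def using A h
    by (intro total_recursive_seq_code) (auto simp: total_recursive_id bij_betw_def)
  then have T: "recursive_set (\<phi> ` S)"
    using S first by (auto intro!: recursive_set_image_retraction[where g = "seq_proj m 1"]
        total_recursive_seq_proj simp: m_def)
  have "bij_betw \<phi> S (\<phi> ` S)"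
    by (metis first inj_onI inj_on_imp_bij_betw)
  \<comment> \<open>For \<open>i < k\<close> the index \<open>i + 2\<close> lies between 1 and
    \<open>m\<close>, where distinct indices give distinct projections.\<close>
  moreover have "bij_betw (\<lambda>i. seq_proj m (Suc (Suc i))) {0..<k} B"
    unfolding B_def
    by (intro inj_on_imp_bij_betw inj_onI) (auto simp: m_def dest: inj_onD[OF inj_on_seq_proj])
  then have "bij_betw \<psi> A B"
    unfolding \<psi>_def using bij_betw_inv_into[OF h] by (rule bij_betw_trans[rotated])
  moreover have "\<alpha> s = \<psi> \<alpha> (\<phi> s)" if "\<alpha> \<in> A" for \<alpha> s
  proof -
    have "\<alpha> \<in> h ` {0..<k}"
      using that h by (simp add: bij_betw_imp_surj_on)
    then obtain i where "i < k" "\<alpha> = h i" by auto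
    moreover from this have "inv_into {0..<k} h \<alpha> = i"
      using h by (simp add: bij_betw_inv_into_left)
    ultimately show ?thesis by (simp add: \<psi>_def proj)
  qed
  ultimately have "isomorphic_models (S, A) (\<phi> ` S, B)"
    unfolding isomorphic_models.simps by blast
  moreover have "computable_model (\<phi> ` S, B)"
    using T by (auto simp: B_def m_def intro!: total_recursive_seq_proj)
  moreover have "B \<subseteq> {seq_proj m i | i. 1 \<le> i \<and> i \<le> m}"
    by (force simp: B_def m_def)
  moreover have "1 \<le> m" by (simp add: m_def)
  ultimately show ?thesis by blast
qed

end
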